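(* Let $g\ge 1$ and let $T=(V,A,E)$ be a tree compression of the rook graph $\mathbf{R}_{g\times g}$. Then the number $|E|$ of compression edges is at least $g^3/32-g^2$.
   Context: The rook graph is the directed graph $\mathbf{R}_{g\times g}=(\mathbf{V},\mathbf{E})$ with $\mathbf{V}=\{1,\dots,g\}\times\{1,\dots,g\}$ and $\mathbf{E}=\{((r_1,c_1),(r_2,c_2))\mid r_1=r_2 \text{ or } c_1=c_2\}$ (in particular it contains all loops). A DAG compression of a directed graph $(\mathbf{V},\mathbf{E})$ is a triple $(V,A,E)$ where $(V,A)$ is a directed acyclic graph whose set of sinks (vertices of out-degree $0$) is exactly $\mathbf{V}\subseteq V$; for $v\in V$ the cluster $\mathbf{C}(v)$ is the set of sinks reachable from $v$ in $(V,A)$; and $E\subseteq V\times V$ is a set of compression edges with $\mathbf{E}=\bigcup_{(u,v)\in E}\mathbf{C}(u)\times\mathbf{C}(v)$. A tree compression is a DAG compression in which $(V,A)$ is a (rooted, directed) tree, i.e. there is a root from which every vertex is reached by a unique path. *)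

theory Defs
  imports Complex_Main "Graph_Theory.Pair_Digraph"
begin

definition rook_digraph :: "nat \<Rightarrow> (nat \<times> nat) pair_pre_digraph" where
  "rook_digraph g =
     \<lparr>pverts = {1..g} \<times> {1..g},
      parcs = {((r1, c1), (r2, c2)) | r1 c1 r2 c2.
        (r1, c1) \<in> {1..g} \<times> {1..g} \<and> (r2, c2) \<in> {1..g} \<times> {1..g} \<and> (r1 = r2 \<or> c1 = c2)}\<rparr>"

(* Renaming of vertices. A compression has the vertices of the compressed graph among its own,
   so both live in one type; renaming along an injection keeps that type arbitrary. *)
definition rename_digraph :: "('a \<Rightarrow> 'b) \<Rightarrow> 'a pair_pre_digraph \<Rightarrow> 'b pair_pre_digraph" where
  "rename_digraph f H = \<lparr>pverts = f ` pverts H, parcs = map_prod f f ` parcs H\<rparr>"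

context pre_digraph
begin

definition sinks :: "'a set" where
  "sinks = {v \<in> verts G. out_degree G v = 0}"

definition cluster :: "'a \<Rightarrow> 'a set" where
  "cluster v = {s \<in> sinks. v \<rightarrow>\<^sup>* s}"

end

(* G is the digraph (V, A) of the compression, H the compressed digraph, and E the set of
   compression edges. Graphs are finite; in particular out_degree, a cardinality, vanishes
   only when there are no outgoing arcs. *)
locale dag_compression = pair_fin_digraph G
  for G :: "'v pair_pre_digraph" +
  fixes H :: "'v pair_pre_digraph"
    and E :: "('v \<times> 'v) set"
  assumes acyclic_arcs: "acyclic (parcs G)"
    and sinks_eq: "sinks = pverts H"
    and compression_edges: "E \<subseteq> pverts G \<times> pverts G"
    and arcs_eq: "parcs H = (\<Union>(u, v)\<in>E. cluster u \<times> cluster v)"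

locale tree_compression = dag_compression +
  assumes rooted_tree: "\<exists>r\<in>pverts G. \<forall>v\<in>pverts G. \<exists>!p. apath r p v"

end

theory Submission
  imports Defs
begin

text \<open>
  The clusters of a tree compression form a laminar family, so a cell cannot lie in a cluster with
  at least two cells contained in a row and also in one contained in a column. By symmetry we may
  assume that a set \<open>S\<close> of at least half of the cells avoids the latter. By convexity \<open>S\<close> contains
  at least \<open>g\<^sup>3/4 - g\<^sup>2\<close> ordered pairs \<open>(x, y)\<close> of distinct cells in a common column. A compression
  edge between clusters with at most two cells covers at most four of them. If \<open>(x, y)\<close> is covered
  by a larger cluster on the side of \<open>y\<close>, then this cluster is contained in the cross of \<open>x\<close> but in
  no line, which determines \<open>x\<close>; laminarity shows that then \<open>y\<close> alone determines \<open>x\<close>, so there are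
  at most \<open>g\<^sup>2\<close> such pairs, and likewise on the side of \<open>x\<close>.
\<close>

section \<open>Counting column pairs for an abstract laminar family of clusters\<close>

locale laminar_rook_cover =
  fixes V :: "'v set" and p q :: "'v \<Rightarrow> nat" and g :: nat
    and C :: "'w \<Rightarrow> 'v set" and E :: "('w \<times> 'w) set"
  assumes finite_V: "finite V"
    and coords_inj: "inj_on (\<lambda>x. (p x, q x)) V"
    and q_range: "q ` V \<subseteq> {1..g}"
    and card_V: "card V = g\<^sup>2"
    and finite_E: "finite E"
    and cluster_subset: "C w \<subseteq> V"
    and laminar: "x \<in> C u \<Longrightarrow> x \<in> C v \<Longrightarrow> C u \<subseteq> C v \<or> C v \<subseteq> C u"
    and cover: "x \<in> V \<Longrightarrow> y \<in> V \<Longrightarrow>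
      (p x = p y \<or> q x = q y) \<longleftrightarrow> (\<exists>(u, v)\<in>E. x \<in> C u \<and> y \<in> C v)"
begin

text \<open>The set S of the overview, with the fibres of \<open>q\<close> as columns. Singleton
  clusters do no harm in the count and are allowed.\<close>

definition free_cells :: "'v set" where
  "free_cells = {x \<in> V. \<forall>w. x \<in> C w \<longrightarrow> (\<forall>y\<in>C w. q y = q x) \<longrightarrow> C w = {x}}"

definition column_pairs :: "('v \<times> 'v) set" where
  "column_pairs = {(x, y). x \<in> free_cells \<and> y \<in> free_cells \<and> q x = q y \<and> x \<noteq> y}"

lemma free_cells_subset: "free_cells \<subseteq> V"
  by (auto simp: free_cells_def)

lemma finite_cluster: "finite (C w)"
  using finite_V cluster_subset by (rule finite_subset[rotated])

lemma coords_eqD: "x \<in> V \<Longrightarrow> y \<in> V \<Longrightarrow> p x = p y \<Longrightarrow> q x = q y \<Longrightarrow> x = y"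
  using coords_inj by (auto dest: inj_onD)

lemma edge_adjacent:
  "(u, v) \<in> E \<Longrightarrow> x \<in> C u \<Longrightarrow> y \<in> C v \<Longrightarrow> p x = p y \<or> q x = q y"
  using cover[of x y] cluster_subset by blast

text \<open>Here \<open>y\<close> lies on the column and \<open>z\<close> on the row of
  \<open>x\<close>, both off \<open>x\<close>. The only other position whose cross contains both is
  the fourth corner of the rectangle spanned by \<open>x\<close>, \<open>y\<close> and
  \<open>z\<close>. The cross of that corner meets the cross of \<open>x\<close> only in
  \<open>y\<close> and \<open>z\<close>, so a third cell of \<open>B\<close> excludes it.\<close>

lemma cross_center_unique:
  assumes x: "x \<in> V" and x': "x' \<in> V"
    and B: "B \<subseteq> V" "card B \<ge> 3"
    and y: "y \<in> B" "p y \<noteq> p x" and z: "z \<in> B" "q z \<noteq> q x"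
    and cross: "\<And>b. b \<in> B \<Longrightarrow> p x = p b \<or> q x = q b"
    and cross': "\<And>b. b \<in> B \<Longrightarrow> p x' = p b \<or> q x' = q b"
  shows "x' = x"
proof -
  have "\<not> B \<subseteq> {y, z}"
  proof
    assume "B \<subseteq> {y, z}"
    then have "card B \<le> card {y, z}"
      by (intro card_mono) auto
    then show False
      using B(2) card_insert_le_m1[of 2 "{z}" y] by (auto simp: card_insert_if split: if_splits)
  qed
  then obtain w where w: "w \<in> B" "w \<noteq> y" "w \<noteq> z"
    by blast
  have "p w = p y \<longrightarrow> q w \<noteq> q y" "p w = p z \<longrightarrow> q w \<noteq> q z"
    using w y(1) z(1) B(1) coords_eqD by blast+
  then have "p x' = p x \<and> q x' = q x"
    using cross[OF y(1)] cross[OF z(1)] cross[OF w(1)]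
      cross'[OF y(1)] cross'[OF z(1)] cross'[OF w(1)] y(2) z(2)
    by (smt (verit))
  then show ?thesis
    using x x' coords_eqD by blast
qed

text \<open>The compression edge is left out on purpose: the same set with its pairs swapped then
  handles large clusters on the side of \<open>x\<close>.\<close>

definition cross_pairs :: "('v \<times> 'v) set" where
  "cross_pairs = {(x, y) \<in> column_pairs.
     \<exists>w. y \<in> C w \<and> card (C w) \<ge> 3 \<and> (\<forall>b\<in>C w. p x = p b \<or> q x = q b)}"

text \<open>The second cell determines the first. If \<open>x\<close> and \<open>x'\<close> both
  pair with \<open>y\<close>, laminarity nests their two clusters through \<open>y\<close>; the
  smaller one lies in both crosses, and its center is unique.\<close>

lemma card_cross_pairs_le: "card cross_pairs \<le> g\<^sup>2"
proof -
  have aux: "x' = x"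
    if xy: "(x, y) \<in> column_pairs" and x': "x' \<in> V"
      and w: "y \<in> C w" "card (C w) \<ge> 3" "\<forall>b\<in>C w. p x = p b \<or> q x = q b"
      and w': "\<forall>b\<in>C w. p x' = p b \<or> q x' = q b"
    for x x' y w
  proof -
    have "q x = q y" "x \<noteq> y" and free: "x \<in> free_cells" "y \<in> free_cells"
      using xy by (auto simp: column_pairs_def)
    then have py: "p y \<noteq> p x"
      using coords_eqD[of x y] subsetD[OF free_cells_subset free(1)] subsetD[OF free_cells_subset free(2)]
      by auto
    \<comment> \<open>As \<open>y\<close> is free, this large cluster must leave the column of
      \<open>y\<close>, which is that of \<open>x\<close>. So it has a cell \<open>z\<close> off the
      column of \<open>x\<close>, while \<open>y\<close> itself is off the row of
      \<open>x\<close>.\<close>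
    have "C w \<noteq> {y}"
      using w(2) by auto
    then obtain z where "z \<in> C w" "q z \<noteq> q x"
      using free(2) w(1) \<open>q x = q y\<close> unfolding free_cells_def by auto
    then show ?thesis
      using cross_center_unique[of x x' "C w" y z] py w w' x' free free_cells_subset cluster_subset
      by blast
  qed
  have "inj_on snd cross_pairs"
  proof (rule inj_onI, clarsimp)
    fix x x' y
    assume a: "(x, y) \<in> cross_pairs" "(x', y) \<in> cross_pairs"
    then obtain w w' where
      w: "y \<in> C w" "card (C w) \<ge> 3" "\<forall>b\<in>C w. p x = p b \<or> q x = q b" and
      w': "y \<in> C w'" "card (C w') \<ge> 3" "\<forall>b\<in>C w'. p x' = p b \<or> q x' = q b"
      unfolding cross_pairs_def by blast
    have xs: "(x, y) \<in> column_pairs" "(x', y) \<in> column_pairs" "x \<in> V" "x' \<in> V"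
      using a free_cells_subset by (auto simp: cross_pairs_def column_pairs_def)
    from laminar[OF w(1) w'(1)] show "x = x'"
    proof
      assume "C w \<subseteq> C w'"
      then show ?thesis
        using aux[of x y x' w] xs w w' by blast
    next
      assume "C w' \<subseteq> C w"
      then show ?thesis
        using aux[of x' y x w'] xs w w' by blast
    qed
  qed
  moreover have "snd ` cross_pairs \<subseteq> V"
    using free_cells_subset by (auto simp: cross_pairs_def column_pairs_def)
  ultimately show ?thesis
    using card_inj_on_le[of snd cross_pairs V] finite_V card_V by simp
qed

lemma finite_column_pairs: "finite column_pairs"
  by (rule finite_subset[of _ "V \<times> V"])
    (use finite_V free_cells_subset in \<open>auto simp: column_pairs_def\<close>)

text \<open>The threshold between small and large is the three cells required by
  \<open>cross_center_unique\<close>. The factor 4 is 2 * 2 for an edge between small clusters; each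
  side of an edge contributes one \<open>g\<^sup>2\<close> for its large clusters.\<close>

lemma card_column_pairs_le: "card column_pairs \<le> 4 * card E + 2 * g\<^sup>2"
proof -
  define small where "small = {(u, v) \<in> E. card (C u) \<le> 2 \<and> card (C v) \<le> 2}"
  have small_E: "small \<subseteq> E"
    by (auto simp: small_def)
  have "column_pairs \<subseteq> (\<Union>(u, v)\<in>small. C u \<times> C v) \<union> cross_pairs \<union> prod.swap ` cross_pairs"
  proof (rule subrelI)
    fix x y
    assume xy: "(x, y) \<in> column_pairs"
    then have yx: "(y, x) \<in> column_pairs"
      by (auto simp: column_pairs_def)
    have "x \<in> V" "y \<in> V" "q x = q y"
      using xy free_cells_subset by (auto simp: column_pairs_def)
    then obtain u v where uv: "(u, v) \<in> E" "x \<in> C u" "y \<in> C v"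
      using cover[of x y] by blast
    \<comment> \<open>The edge makes \<open>x\<close> adjacent to all of \<open>C v\<close> and
      \<open>y\<close> adjacent to all of \<open>C u\<close>, so a large cluster on either side lies
      in the cross of the opposite cell.\<close>
    consider "card (C v) \<ge> 3" | "card (C u) \<ge> 3" | "(u, v) \<in> small"
      using uv(1) by (fastforce simp: small_def)
    then show "(x, y) \<in> (\<Union>(u, v)\<in>small. C u \<times> C v) \<union> cross_pairs \<union> prod.swap ` cross_pairs"
    proof cases
      case 1
      then have "(x, y) \<in> cross_pairs"
        using xy uv edge_adjacent[OF uv(1,2)] by (auto simp: cross_pairs_def)
      then show ?thesis by blast
    next
      case 2
      moreover have "\<forall>b\<in>C u. p y = p b \<or> q y = q b"
        using edge_adjacent[OF uv(1) _ uv(3)] by fastforce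
      ultimately have "(y, x) \<in> cross_pairs"
        using yx uv by (auto simp: cross_pairs_def)
      then show ?thesis by force
    next
      case 3
      then show ?thesis
        using uv by blast
    qed
  qed
  moreover have fin: "finite small" "finite cross_pairs"
    using small_E finite_E finite_column_pairs
    by (auto intro: finite_subset simp: cross_pairs_def)
  ultimately have "card column_pairs \<le>
    card ((\<Union>(u, v)\<in>small. C u \<times> C v) \<union> cross_pairs \<union> prod.swap ` cross_pairs)"
    using finite_cluster by (intro card_mono) auto
  also have "\<dots> \<le> card (\<Union>(u, v)\<in>small. C u \<times> C v) + card cross_pairs
      + card (prod.swap ` cross_pairs)"
    by (meson add_le_mono1 card_Un_le order_trans)
  also have "card (prod.swap ` cross_pairs) \<le> g\<^sup>2"
    using card_image_le[OF fin(2)] card_cross_pairs_le by (rule order_trans)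
  also have "card (\<Union>(u, v)\<in>small. C u \<times> C v) \<le> (\<Sum>(u, v)\<in>small. card (C u \<times> C v))"
    using card_UN_le[OF fin(1), of "\<lambda>(u, v). C u \<times> C v"] by (simp add: case_prod_unfold)
  also have "\<dots> \<le> (\<Sum>e\<in>small. 4)"
  proof (rule sum_mono, clarsimp simp: small_def card_cartesian_product)
    fix u v
    assume "card (C u) \<le> 2" "card (C v) \<le> 2"
    then show "card (C u) * card (C v) \<le> 4"
      using mult_mono[of "card (C u)" 2 "card (C v)" 2] by simp
  qed
  also have "\<dots> \<le> 4 * card E"
    using card_mono[OF finite_E small_E] by simp
  finally show ?thesis
    using card_cross_pairs_le by linarith
qed

text \<open>Pairs within columns, diagonal included, number the sum of the squared column sizes.
  With g columns and at least \<open>g\<^sup>2/2\<close> free cells this is at least g * (g/2)^2,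
  and the diagonal takes away at most \<open>g\<^sup>2\<close>.\<close>

lemma card_column_pairs_ge:
  assumes half: "2 * card free_cells \<ge> g\<^sup>2"
  shows "real (card column_pairs) \<ge> real g ^ 3 / 4 - real g ^ 2"
proof -
  define s where "s c = {x \<in> free_cells. q x = c}" for c
  have fin: "finite free_cells"
    using finite_V free_cells_subset by (rule finite_subset[rotated])
  have fin_s: "finite (s c)" for c
    using fin by (simp add: s_def)
  have free_eq: "free_cells = (\<Union>c\<in>{1..g}. s c)"
    using q_range free_cells_subset by (auto simp: s_def)
  have sum_s: "card free_cells = (\<Sum>c\<in>{1..g}. card (s c))"
    by (subst free_eq, rule card_UN_disjoint) (use fin_s in \<open>auto simp: s_def\<close>)
  have all_pairs: "(\<Union>c\<in>{1..g}. s c \<times> s c) = column_pairs \<union> (\<lambda>x. (x, x)) ` free_cells"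
    using q_range free_cells_subset by (auto simp: s_def column_pairs_def)
  have "(\<Sum>c\<in>{1..g}. (card (s c))\<^sup>2) = (\<Sum>c\<in>{1..g}. card (s c \<times> s c))"
    by (simp add: card_cartesian_product power2_eq_square)
  also have "\<dots> = card (\<Union>c\<in>{1..g}. s c \<times> s c)"
    by (rule card_UN_disjoint[symmetric]) (use fin_s in \<open>auto simp: s_def\<close>)
  also have "\<dots> \<le> card column_pairs + card ((\<lambda>x. (x, x)) ` free_cells)"
    unfolding all_pairs by (rule card_Un_le)
  also have "\<dots> \<le> card column_pairs + card free_cells"
    using card_image_le[OF fin] by simp
  also have "card free_cells \<le> g\<^sup>2"
    using card_mono[OF finite_V free_cells_subset] card_V by simp
  finally have upper: "(\<Sum>c\<in>{1..g}. (card (s c))\<^sup>2) \<le> card column_pairs + g\<^sup>2"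
    by simp
  have "real g ^ 3 / 4 \<le> real g * card free_cells - real g * (real g ^ 2 / 4)"
    using mult_left_mono[of "real (g\<^sup>2)" "real (2 * card free_cells)" "real g"] half
    by (simp add: power3_eq_cube power2_eq_square del: of_nat_mult) (simp add: algebra_simps)
  also have "\<dots> = (\<Sum>c\<in>{1..g}. real g * card (s c) - real g ^ 2 / 4)"
    by (simp add: sum_s sum_distrib_left sum_subtractf)
  also have "\<dots> \<le> (\<Sum>c\<in>{1..g}. (real (card (s c)))\<^sup>2)"
  proof (rule sum_mono)
    fix c
    \<comment> \<open>Convexity enters as the tangent of the square function at g/2, the mean column
      size when exactly half of the cells are free.\<close>
    have "0 \<le> (real (card (s c)) - real g / 2)\<^sup>2"
      by simp
    then show "real g * card (s c) - real g ^ 2 / 4 \<le> (real (card (s c)))\<^sup>2"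
      by (simp add: power2_eq_square algebra_simps)
  qed
  also have "\<dots> = real (\<Sum>c\<in>{1..g}. (card (s c))\<^sup>2)"
    by simp
  also have "\<dots> \<le> real (card column_pairs) + real g ^ 2"
    using upper by (metis of_nat_add of_nat_le_iff of_nat_power)
  finally show ?thesis by simp
qed

lemma card_edges_ge_if_half_free:
  assumes "2 * card free_cells \<ge> g\<^sup>2"
  shows "real (card E) \<ge> real g ^ 3 / 32 - real g ^ 2"
proof -
  have "real (card column_pairs) \<le> 4 * real (card E) + 2 * real g ^ 2"
    using card_column_pairs_le by (simp flip: of_nat_power of_nat_add of_nat_mult)
  then have "4 * real (card E) \<ge> real g ^ 3 / 4 - 3 * real g ^ 2"
    using card_column_pairs_ge[OF assms] by linarith
  \<comment> \<open>The bound so far is g^3/16 - 3g^2/4; nonnegativity lets it be weakened to the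
    target.\<close>
  moreover have "real g ^ 3 \<ge> 0" "real g ^ 2 \<ge> 0"
    by simp_all
  ultimately show ?thesis by linarith
qed

end

section \<open>Symmetry between rows and columns\<close>

lemma laminar_rook_cover_card_edges:
  assumes "laminar_rook_cover V p q g C E" and p_range: "p ` V \<subseteq> {1..g}"
  shows "real (card E) \<ge> real g ^ 3 / 32 - real g ^ 2"
proof -
  interpret col: laminar_rook_cover V p q g C E by fact
  \<comment> \<open>Exchanging the coordinate functions turns rows into columns, so the whole count
    applies to either direction.\<close>
  interpret row: laminar_rook_cover V q p g C E
  proof
    show "inj_on (\<lambda>x. (q x, p x)) V"
      using col.coords_eqD by (auto intro!: inj_onI)
    show "(q x = q y \<or> p x = p y) \<longleftrightarrow> (\<exists>(u, v)\<in>E. x \<in> C u \<and> y \<in> C v)"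
      if "x \<in> V" "y \<in> V" for x y
      using col.cover[OF that] by blast
  qed (use col.finite_V col.card_V col.finite_E col.cluster_subset col.laminar p_range in auto)
  have "V \<subseteq> col.free_cells \<union> row.free_cells"
  proof
    fix x
    assume "x \<in> V"
    show "x \<in> col.free_cells \<union> row.free_cells"
    proof (rule ccontr)
      assume "x \<notin> col.free_cells \<union> row.free_cells"
      then obtain w w' where
        w: "x \<in> C w" "\<forall>y\<in>C w. q y = q x" "C w \<noteq> {x}" and
        w': "x \<in> C w'" "\<forall>y\<in>C w'. p y = p x" "C w' \<noteq> {x}"
        using \<open>x \<in> V\<close> unfolding col.free_cells_def row.free_cells_def by blast
      \<comment> \<open>A row and a column share one cell, so if one of these clusters contained the
        other, the smaller would be the singleton of \<open>x\<close>.\<close>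
      have "C w \<inter> C w' \<subseteq> {x}"
        using w(2) w'(2) col.cluster_subset col.coords_eqD \<open>x \<in> V\<close> by blast
      then show False
        using col.laminar[OF w(1) w'(1)] w w' by blast
    qed
  qed
  then have "g\<^sup>2 \<le> card (col.free_cells \<union> row.free_cells)"
    using col.finite_V col.free_cells_subset row.free_cells_subset
    unfolding col.card_V[symmetric] by (intro card_mono) (auto intro: finite_subset)
  also have "\<dots> \<le> card col.free_cells + card row.free_cells"
    by (rule card_Un_le)
  finally have "2 * card col.free_cells \<ge> g\<^sup>2 \<or> 2 * card row.free_cells \<ge> g\<^sup>2"
    by linarith
  then show ?thesis
    using col.card_edges_ge_if_half_free row.card_edges_ge_if_half_free by blast
qed

section \<open>Laminarity of the clusters of a tree\<close>

lemma (in dag_compression) awalk_imp_apath: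
  assumes "awalk u es v"
  shows "apath u es v"
proof (rule ccontr)
  assume "\<not> apath u es v"
  \<comment> \<open>A repeated vertex splits off a nonempty closed walk, that is, a cycle.\<close>
  then obtain w r where "awalk w r w" "r \<noteq> []"
    using assms awalk_not_distinct_decomp[OF assms] unfolding apath_def by blast
  then have "(w, w) \<in> (parcs G)\<^sup>+"
    using reachable1_awalkI[of w r w] by simp
  then show False
    using acyclic_arcs by (simp add: acyclic_def)
qed

text \<open>Both \<open>u\<close> and \<open>v\<close> lie on the unique path from the root to the
  common sink \<open>s\<close>, so one of them reaches the other and all sinks below it.\<close>

lemma (in tree_compression) clusters_laminar:
  assumes s: "s \<in> cluster u" "s \<in> cluster v"
  shows "cluster u \<subseteq> cluster v \<or> cluster v \<subseteq> cluster u"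
proof -
  obtain r where r: "r \<in> pverts G" "\<And>v. v \<in> pverts G \<Longrightarrow> \<exists>!es. apath r es v"
    using rooted_tree by blast
  obtain a b where ab: "awalk u a s" "awalk v b s"
    using s unfolding cluster_def reachable_awalk by blast
  then have verts: "u \<in> pverts G" "v \<in> pverts G" "s \<in> pverts G"
    by auto
  obtain c d where cd: "awalk r c u" "awalk r d v"
    using r(2)[OF verts(1)] r(2)[OF verts(2)] awalkI_apath by blast
  have "apath r (c @ a) s" "apath r (d @ b) s"
    using awalk_appendI ab cd awalk_imp_apath by blast+
  then have "c @ a = d @ b"
    using r(2)[OF verts(3)] by blast
  \<comment> \<open>Of two prefixes of the same path one extends the other; the difference
    \<open>es\<close> is a walk between \<open>u\<close> and \<open>v\<close>.\<close>
  then obtain es where es: "c = d @ es \<or> d = c @ es"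
    by (auto simp: append_eq_append_conv2)
  have "awlast r c = u" "awlast r d = v"
    using cd by (auto elim: awalkE)
  then have "awalk v es u \<or> awalk u es v"
    using es cd by auto
  then have "v \<rightarrow>\<^sup>*\<^bsub>with_proj G\<^esub> u \<or> u \<rightarrow>\<^sup>*\<^bsub>with_proj G\<^esub> v"
    using reachable_awalkI by blast
  then show ?thesis
    unfolding cluster_def using reachable_trans by blast
qed

section \<open>Application to the renamed rook graph\<close>

theorem theorem2:
  fixes g :: nat
    and \<iota> :: "nat \<times> nat \<Rightarrow> 'v"
    and T :: "'v pair_pre_digraph"
    and E :: "('v \<times> 'v) set"
  assumes "g \<ge> 1"
    and "inj_on \<iota> (pverts (rook_digraph g))"
    and "tree_compression T (rename_digraph \<iota> (rook_digraph g)) E"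
  shows "real (card E) \<ge> real g ^ 3 / 32 - real g ^ 2"
proof -
  interpret tree_compression T "rename_digraph \<iota> (rook_digraph g)" E by fact
  define cells where "cells = {1..g} \<times> {1..g}"
  \<comment> \<open>Reads the coordinates off a sink. It inverts \<iota> only on the image of
    \<open>cells\<close>, which is exactly the set of sinks.\<close>
  define \<kappa> where "\<kappa> = inv_into cells \<iota>"
  have inj: "inj_on \<iota> cells"
    using assms(2) by (simp add: rook_digraph_def cells_def)
  have \<kappa>: "\<kappa> (\<iota> x) = x" if "x \<in> cells" for x
    unfolding \<kappa>_def using inj that by (rule inv_into_f_f)
  have sinks: "sinks = \<iota> ` cells"
    using sinks_eq by (simp add: rename_digraph_def rook_digraph_def cells_def)
  have arcs: "(\<iota> a, \<iota> b) \<in> (\<Union>(u, v)\<in>E. cluster u \<times> cluster v) \<longleftrightarrow> fst a = fst b \<or> snd a = snd b"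
    if ab: "a \<in> cells" "b \<in> cells" for a b
  proof -
    have "(\<iota> a, \<iota> b) \<in> map_prod \<iota> \<iota> ` parcs (rook_digraph g) \<longleftrightarrow> (a, b) \<in> parcs (rook_digraph g)"
    proof
      assume "(\<iota> a, \<iota> b) \<in> map_prod \<iota> \<iota> ` parcs (rook_digraph g)"
      then obtain a' b' where *: "(a', b') \<in> parcs (rook_digraph g)" "\<iota> a = \<iota> a'" "\<iota> b = \<iota> b'"
        by auto
      then have "a' \<in> cells" "b' \<in> cells"
        by (auto simp: rook_digraph_def cells_def)
      then have "a = a'" "b = b'"
        using inj_onD[OF inj *(2)] inj_onD[OF inj *(3)] ab by blast+
      then show "(a, b) \<in> parcs (rook_digraph g)"
        using *(1) by simp
    qed force
    also have "\<dots> \<longleftrightarrow> fst a = fst b \<or> snd a = snd b"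
      using ab by (cases a; cases b) (auto simp: rook_digraph_def cells_def)
    finally show ?thesis
      using arcs_eq by (simp add: rename_digraph_def)
  qed
  have "laminar_rook_cover sinks (fst \<circ> \<kappa>) (snd \<circ> \<kappa>) g cluster E"
  proof
    show "finite sinks"
      by (simp add: sinks cells_def)
    show "inj_on (\<lambda>x. ((fst \<circ> \<kappa>) x, (snd \<circ> \<kappa>) x)) sinks"
      by (auto simp: sinks \<kappa> intro!: inj_onI)
    show "(snd \<circ> \<kappa>) ` sinks \<subseteq> {1..g}"
      by (auto simp: sinks \<kappa>) (auto simp: cells_def)
    show "card sinks = g\<^sup>2"
      using card_image[OF inj] by (simp add: sinks cells_def power2_eq_square)
    show "finite E"
      using compression_edges pair_finite_verts by (meson finite_SigmaI finite_subset)
    show "cluster w \<subseteq> sinks" for w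
      by (auto simp: cluster_def)
    show "cluster u \<subseteq> cluster v \<or> cluster v \<subseteq> cluster u"
      if "x \<in> cluster u" "x \<in> cluster v" for x u v
      using that by (rule clusters_laminar)
    show "((fst \<circ> \<kappa>) x = (fst \<circ> \<kappa>) y \<or> (snd \<circ> \<kappa>) x = (snd \<circ> \<kappa>) y) \<longleftrightarrow>
        (\<exists>(u, v)\<in>E. x \<in> cluster u \<and> y \<in> cluster v)"
      if "x \<in> sinks" "y \<in> sinks" for x y
    proof -
      obtain a b where "x = \<iota> a" "y = \<iota> b" "a \<in> cells" "b \<in> cells"
        using \<open>x \<in> sinks\<close> \<open>y \<in> sinks\<close> by (auto simp: sinks)
      then show ?thesis
        using arcs[of a b] \<kappa> by (auto simp: case_prod_unfold)
    qed
  qed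
  moreover have "(fst \<circ> \<kappa>) ` sinks \<subseteq> {1..g}"
    by (auto simp: sinks \<kappa>) (auto simp: cells_def)
  ultimately show ?thesis
    by (rule laminar_rook_cover_card_edges)
qed

end
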